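(* Let $n\geq 1$ be a natural number, let $I\subset\mathbb{R}$ be an interval, let $f:I\to\mathbb{R}$ be $n$-times differentiable, and let $a,b\in I$ with $a<b$. If $f^{(n)}\in L[a,b]$ and $|f^{(n)}|$ is convex on $[a,b]$, then $$\left|\int_a^b f(t)\,dt-\sum_{k=0}^{n-1}\left(\frac{1+(-1)^k}{2^{k+1}(k+1)!}\right)(b-a)^{k+1}f^{(k)}\left(\frac{a+b}{2}\right)\right|\leq \frac{(b-a)^{n+1}}{2^n(n+1)!}\left(\frac{|f^{(n)}(a)|+|f^{(n)}(b)|}{2}\right).$$
   Context: $f^{(k)}$ denotes the $k$-th derivative of $f$, with $f^{(0)}=f$; $L[a,b]$ denotes the space of (Lebesgue) integrable functions on $[a,b]$. A function $g:[a,b]\to\mathbb{R}$ is convex if $g(tx+(1-t)y)\leq t g(x)+(1-t)g(y)$ for all $x,y\in[a,b]$ and $t\in[0,1]$. *)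

theory Defs
  imports "HOL-Analysis.Analysis"
begin

text \<open>
  The k-th derivative of \<open>f\<close> relative to a set \<open>S\<close>. Derivatives are taken within \<open>S\<close>, so that at
  an endpoint belonging to an interval \<open>S\<close> they are the one-sided ones, and two-sided in the interior.
  For real functions the vector derivative is the ordinary derivative; it is unique
  whenever \<open>S\<close> is a nondegenerate interval. Values outside \<open>S\<close> are irrelevant.
\<close>

primrec nth_deriv_on :: "real set \<Rightarrow> nat \<Rightarrow> (real \<Rightarrow> real) \<Rightarrow> real \<Rightarrow> real" where
  "nth_deriv_on S 0 f = f"
| "nth_deriv_on S (Suc k) f = (\<lambda>x. vector_derivative (nth_deriv_on S k f) (at x within S))"

definition times_differentiable_on :: "nat \<Rightarrow> (real \<Rightarrow> real) \<Rightarrow> real set \<Rightarrow> bool" where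
  "times_differentiable_on n f S \<longleftrightarrow> (\<forall>k<n. nth_deriv_on S k f differentiable_on S)"

end

(* Let m = (a + b)/2 and h = (b - a)/2. The odd function G x = integral of f over [m - x, m + x]
   has G^(k+1)(0) = (1 + (-1)^k) f^(k)(m), so the sum in the theorem is the Taylor polynomial of G
   at 0, evaluated at h. Convexity of |f^(n)| on the symmetric pair m + x, m - x bounds |G^(n+1)| by
   |f^(n)(a)| + |f^(n)(b)| on [0, h], and the Taylor remainder estimate gives the claim. *)
theory Submission
  imports Defs
begin

text \<open>The remainder in integral form has kernel
  \<open>(b - x) ^ (p - 1) / fact (p - 1)\<close>, which is nonnegative on the interval, so
  \<open>M\<close> times the kernel dominates the integrand and can be integrated exactly.\<close>

lemma Taylor_remainder_bound:
  fixes Df :: "nat \<Rightarrow> real \<Rightarrow> real"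
  assumes "a \<le> b" and "p > 0"
    and deriv: "\<And>k t. k < p \<Longrightarrow> t \<in> {a..b} \<Longrightarrow>
      (Df k has_vector_derivative Df (Suc k) t) (at t within {a..b})"
    and bound: "\<And>t. t \<in> {a..b} \<Longrightarrow> \<bar>Df p t\<bar> \<le> M"
  shows "\<bar>Df 0 b - (\<Sum>k<p. (b - a) ^ k / fact k * Df k a)\<bar> \<le> M * (b - a) ^ p / fact p"
proof -
  obtain q where q: "p = Suc q"
    using \<open>p > 0\<close> by (cases p) auto
  let ?i = "\<lambda>x. ((b - x) ^ (p - 1) / fact (p - 1)) *\<^sub>R Df p x"
  let ?g = "\<lambda>x. M * (b - x) ^ q / fact q"
  have rem: "(?i has_integral Df 0 b - (\<Sum>k<p. ((b - a) ^ k / fact k) *\<^sub>R Df k a)) {a..b}"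
    by (rule Taylor_has_integral) (use assms in auto)
  \<comment> \<open>This antiderivative of the majorant vanishes at \<open>b\<close>, so only the
    value at \<open>a\<close> contributes to the integral.\<close>
  have "((\<lambda>x. - M * (b - x) ^ Suc q / fact (Suc q)) has_vector_derivative ?g x) (at x within {a..b})" for x
  proof -
    have "((\<lambda>x. - M * (b - x) ^ Suc q / fact (Suc q)) has_real_derivative
        M * (real (Suc q) * (b - x) ^ q) / fact (Suc q)) (at x within {a..b})"
      by (auto intro!: derivative_eq_intros simp del: fact_Suc power_Suc)
    also have "M * (real (Suc q) * (b - x) ^ q) / fact (Suc q) = ?g x"
      by (simp add: divide_simps)
    finally show ?thesis
      by (simp add: has_real_derivative_iff_has_vector_derivative)
  qed
  from fundamental_theorem_of_calculus[OF \<open>a \<le> b\<close> this]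
  have g: "(?g has_integral M * (b - a) ^ p / fact p) {a..b}"
    by (simp add: q)
  have "norm (?i x) \<le> ?g x" if "x \<in> {a..b}" for x
  proof -
    have "(b - x) ^ q / fact q * \<bar>Df p x\<bar> \<le> (b - x) ^ q / fact q * M"
      using that by (intro mult_left_mono bound) auto
    then show ?thesis
      using that by (simp add: q abs_mult mult.commute)
  qed
  then have "norm (integral {a..b} ?i) \<le> integral {a..b} ?g"
    using rem g by (intro integral_norm_bound_integral) (auto simp: has_integral_integrable)
  then show ?thesis
    unfolding integral_unique[OF rem] integral_unique[OF g] by simp
qed

text \<open>By the chain rule the reflected term changes sign, so the derivative has the same shape
  with \<open>- c\<close> in place of \<open>c\<close>. This allows repeated
  differentiation.\<close>

lemma has_vector_derivative_reflected_sum: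
  fixes g :: "real \<Rightarrow> real"
  assumes g: "\<And>y. y \<in> {m - h..m + h} \<Longrightarrow> (g has_vector_derivative g' y) (at y within {m - h..m + h})"
    and "x \<in> {0..h}"
  shows "((\<lambda>x. g (m + x) + c * g (m - x)) has_vector_derivative g' (m + x) - c * g' (m - x))
    (at x within {0..h})"
proof -
  have "((g \<circ> (\<lambda>x. m + x)) has_vector_derivative 1 *\<^sub>R g' (m + x)) (at x within {0..h})"
    using \<open>x \<in> {0..h}\<close>
    by (intro vector_diff_chain_within has_vector_derivative_within_subset[OF g])
      (auto intro!: derivative_eq_intros)
  moreover have "((g \<circ> (\<lambda>x. m - x)) has_vector_derivative (- 1) *\<^sub>R g' (m - x)) (at x within {0..h})"
    using \<open>x \<in> {0..h}\<close>
    by (intro vector_diff_chain_within has_vector_derivative_within_subset[OF g])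
      (auto intro!: derivative_eq_intros)
  ultimately show ?thesis
    by (auto simp: o_def has_real_derivative_iff_has_vector_derivative[symmetric]
        intro!: derivative_eq_intros)
qed

text \<open>The points \<open>m + x\<close> and \<open>m - x\<close> are convex combinations of the
  two endpoints with interchanged weights. Adding the two convexity inequalities gives each endpoint
  total weight 1.\<close>

lemma convex_on_reflected_sum_le:
  fixes g :: "real \<Rightarrow> real"
  assumes "convex_on {m - h..m + h} g" and "x \<in> {0..h}"
  shows "g (m + x) + g (m - x) \<le> g (m - h) + g (m + h)"
proof (cases "h = 0")
  case True
  then show ?thesis using assms by auto
next
  case False
  \<comment> \<open>The weight solves
    \<open>(1 - t) * (m - h) + t * (m + h) = m + x\<close>.\<close>
  define t where "t = (h + x) / (2 * h)"
  have t: "0 \<le> t" "t \<le> 1"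
    using assms False by (auto simp: t_def field_simps)
  have "(1 - t) * (m - h) + t * (m + h) = m + x" "(1 - t) * (m + h) + t * (m - h) = m - x"
    using False by (auto simp: t_def field_simps)
  moreover have "m - h \<in> {m - h..m + h}" "m + h \<in> {m - h..m + h}"
    using assms by auto
  ultimately have "g (m + x) \<le> (1 - t) * g (m - h) + t * g (m + h)"
    "g (m - x) \<le> (1 - t) * g (m + h) + t * g (m - h)"
    using convex_onD[OF assms(1) t, of "m - h" "m + h"]
      convex_onD[OF assms(1) t, of "m + h" "m - h"] by simp_all
  then show ?thesis
    by (simp add: algebra_simps)
qed

lemma times_differentiable_on_has_vector_derivative:
  assumes "times_differentiable_on n f S" "k < n" "x \<in> S"
  shows "(nth_deriv_on S k f has_vector_derivative nth_deriv_on S (Suc k) f x) (at x within S)"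
  using assms by (auto simp: times_differentiable_on_def differentiable_on_def
      vector_derivative_works[symmetric])

theorem theorem1:
  fixes n :: nat and I :: "real set" and f :: "real \<Rightarrow> real" and a b :: real
  assumes "n \<ge> 1"
    and "is_interval I"
    and "times_differentiable_on n f I"
    and "a \<in> I" and "b \<in> I" and "a < b"
    and "nth_deriv_on I n f absolutely_integrable_on {a..b}"
    and "convex_on {a..b} (\<lambda>x. \<bar>nth_deriv_on I n f x\<bar>)"
  shows "\<bar>integral {a..b} f
      - (\<Sum>k<n. ((1 + (-1) ^ k) / (2 ^ (k + 1) * fact (k + 1))) * (b - a) ^ (k + 1)
                  * nth_deriv_on I k f ((a + b) / 2))\<bar>
    \<le> (b - a) ^ (n + 1) / (2 ^ n * fact (n + 1))
        * ((\<bar>nth_deriv_on I n f a\<bar> + \<bar>nth_deriv_on I n f b\<bar>) / 2)"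
proof -
  define m h where "m = (a + b) / 2" and "h = (b - a) / 2"
  have ab: "a = m - h" "b = m + h" "b - a = 2 * h" and "h > 0"
    using \<open>a < b\<close> by (auto simp: m_def h_def field_simps)
  have sub: "{a..b} \<subseteq> I"
    using mem_is_interval_1_I[OF assms(2,4,5)] by auto
  have deriv: "(nth_deriv_on I k f has_vector_derivative nth_deriv_on I (Suc k) f x) (at x within {a..b})"
    if "k < n" "x \<in> {a..b}" for k x
    using times_differentiable_on_has_vector_derivative[OF assms(3)] that sub
    by (blast intro: has_vector_derivative_within_subset)
  \<comment> \<open>Here \<open>n \<ge> 1\<close> enters, at level \<open>k = 0\<close>. Continuity
    of \<open>f\<close> then makes its integral differentiable at every point.\<close>
  have "f differentiable_on {a..b}"
    using assms(1,3) sub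
    by (auto simp: times_differentiable_on_def dest!: spec[of _ 0] intro: differentiable_on_subset)
  then have cont: "continuous_on {a..b} f"
    by (rule differentiable_imp_continuous_on)
  \<comment> \<open>Indices shift by one: an antiderivative of \<open>f\<close> sits at level 0, so
    the \<open>n\<close>-th derivative of \<open>f\<close> is \<open>D (Suc n)\<close>.\<close>
  define D where
    "D j = (case j of 0 \<Rightarrow> \<lambda>x. integral {a..x} f | Suc k \<Rightarrow> nth_deriv_on I k f)" for j
  have D_simps: "D 0 = (\<lambda>x. integral {a..x} f)" "D (Suc k) = nth_deriv_on I k f" for k
    by (simp_all add: D_def)
  have D_deriv: "(D j has_vector_derivative D (Suc j) x) (at x within {a..b})"
    if "j < Suc n" "x \<in> {a..b}" for j x
    using that deriv integral_has_vector_derivative[OF cont] by (cases j) (auto simp: D_simps)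
  \<comment> \<open>\<open>G 0 x\<close> is the integral of \<open>f\<close> over
    \<open>[m - x, m + x]\<close>, and \<open>G j\<close> is its \<open>j\<close>-th derivative; the
    sign records the \<open>j\<close> reflections.\<close>
  define G where "G j x = D j (m + x) + (- ((- 1) ^ j)) * D j (m - x)" for j x
  have G_deriv: "(G j has_vector_derivative G (Suc j) x) (at x within {0..h})"
    if "j < Suc n" "x \<in> {0..h}" for j x
    using has_vector_derivative_reflected_sum[OF D_deriv[OF that(1), unfolded ab(1,2)] that(2),
        where c = "- ((- 1) ^ j)"]
    unfolding G_def by simp
  let ?M = "\<bar>nth_deriv_on I n f a\<bar> + \<bar>nth_deriv_on I n f b\<bar>"
  have "\<bar>G (Suc n) x\<bar> \<le> ?M" if "x \<in> {0..h}" for x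
  proof -
    have "\<bar>G (Suc n) x\<bar> \<le> \<bar>nth_deriv_on I n f (m + x)\<bar> + \<bar>nth_deriv_on I n f (m - x)\<bar>"
      unfolding G_def D_simps by (rule order_trans[OF abs_triangle_ineq]) (simp add: abs_mult)
    also have "\<dots> \<le> ?M"
      using convex_on_reflected_sum_le[OF assms(8)[unfolded ab(1,2)] that] by (simp add: ab(1,2))
    finally show ?thesis .
  qed
  \<comment> \<open>The Taylor estimate is used with \<open>p = Suc n\<close>, since
    \<open>G 0\<close> has one more derivative than \<open>f\<close>.\<close>
  then have "\<bar>G 0 h - (\<Sum>j<Suc n. (h - 0) ^ j / fact j * G j 0)\<bar> \<le> ?M * (h - 0) ^ Suc n / fact (Suc n)"
    using \<open>h > 0\<close> by (intro Taylor_remainder_bound G_deriv) auto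
  moreover have "G 0 h = integral {a..b} f"
    by (simp add: G_def D_simps flip: ab(1,2))
  moreover have "(\<Sum>j<Suc n. (h - 0) ^ j / fact j * G j 0) =
      (\<Sum>k<n. ((1 + (- 1) ^ k) / (2 ^ (k + 1) * fact (k + 1))) * (b - a) ^ (k + 1)
        * nth_deriv_on I k f ((a + b) / 2))"
  proof -
    \<comment> \<open>The term \<open>j = 0\<close> drops out, and \<open>j = Suc k\<close> matches
      the summand with index \<open>k\<close>.\<close>
    have "G 0 0 = 0"
      by (simp add: G_def)
    moreover have "h ^ Suc k / fact (Suc k) * G (Suc k) 0 =
        ((1 + (- 1) ^ k) / (2 ^ (k + 1) * fact (k + 1))) * (b - a) ^ (k + 1)
        * nth_deriv_on I k f ((a + b) / 2)" for k
    proof -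
      have "G (Suc k) 0 = (1 + (- 1) ^ k) * nth_deriv_on I k f m"
        by (simp add: G_def D_simps algebra_simps)
      moreover have "(b - a) ^ (k + 1) = 2 ^ (k + 1) * h ^ (k + 1)"
        by (simp only: ab(3) power_mult_distrib)
      ultimately show ?thesis
        by (simp add: m_def del: fact_Suc power_Suc)
    qed
    ultimately show ?thesis
      by (simp add: sum.lessThan_Suc_shift del: fact_Suc power_Suc sum.lessThan_Suc)
  qed
  \<comment> \<open>Of the \<open>n + 1\<close> factors 1/2 in \<open>h ^ Suc n\<close>, one forms
    the mean of the endpoint values.\<close>
  moreover have "?M * (h - 0) ^ Suc n / fact (Suc n) =
      (b - a) ^ (n + 1) / (2 ^ n * fact (n + 1)) * (?M / 2)"
    by (simp add: ab(3) power_mult_distrib del: fact_Suc)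
  ultimately show ?thesis
    by simp
qed

end
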